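(* Let $m\ge2$, $n\ge1$ and $\mathcal{A}\in T_{m,n}$, and let $\mathcal{A}^+=(b_{i_1\cdots i_m})\in T_{m,n}$ be given by $b_{i_1\cdots i_m}=a_{i_1\cdots i_m}-r_{i_1}^+$. Then $\mathcal{A}$ is a doubly $B$-tensor if and only if $\mathcal{A}^+$ is strictly doubly diagonally dominated.
   Context: $[n]=\{1,\dots,n\}$. $T_{m,n}$ is the set of real $m$th order $n$-dimensional tensors $\mathcal{A}=(a_{i_1\cdots i_m})$, $i_1,\dots,i_m\in[n]$. For $i\in[n]$, $r_i^+=\max\{0,\,a_{ij_2\cdots j_m}:(j_2,\dots,j_m)\ne(i,\dots,i)\}$. $\mathcal{A}$ is a doubly $B$-tensor if (1) $a_{i\cdots i}>r_i^+$ for all $i\in[n]$, and (2) for all $i\ne j$ in $[n]$, $$(a_{i\cdots i}-r_i^+)(a_{j\cdots j}-r_j^+)>\sum_{(i_2,\dots,i_m)\ne(i,\dots,i)}(r_i^+-a_{ii_2\cdots i_m})\sum_{(j_2,\dots,j_m)\ne(j,\dots,j)}(r_j^+-a_{jj_2\cdots j_m}).$$ A tensor $\mathcal{B}=(b_{i_1\cdots i_m})$ is strictly doubly diagonally dominated if $b_{ii\cdots i}>0$ for all $i\in[n]$ and for all $i\ne j$ in $[n]$, $$b_{ii\cdots i}b_{jj\cdots j}>\sum_{(i_2,\dots,i_m)\ne(i,\dots,i)}|b_{ii_2\cdots i_m}|\sum_{(j_2,\dots,j_m)\ne(j,\dots,j)}|b_{jj_2\cdots j_m}|.$$ *)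

theory Defs
  imports Complex_Main "HOL-Library.FuncSet"
begin

text \<open>A multi-index \<open>(i\<^sub>1, \<dots>, i\<^sub>m)\<close> over \<open>{1..n}\<close> is a list of length \<open>m\<close>; a tensor is an extensional
  real function on the multi-indices.\<close>

definition multi_indices :: "nat \<Rightarrow> nat \<Rightarrow> nat list set" where
  "multi_indices m n = {is. length is = m \<and> set is \<subseteq> {1..n}}"

definition tensors :: "nat \<Rightarrow> nat \<Rightarrow> (nat list \<Rightarrow> real) set" where
  "tensors m n = (multi_indices m n \<rightarrow>\<^sub>E UNIV)"

definition diag_entry :: "nat \<Rightarrow> (nat list \<Rightarrow> real) \<Rightarrow> nat \<Rightarrow> real" where
  "diag_entry m A i = A (replicate m i)"

text \<open>The tails \<open>(j\<^sub>2, \<dots>, j\<^sub>m) \<noteq> (i, \<dots>, i)\<close>; the corresponding entry of \<open>A\<close> is \<open>A (i # js)\<close>.\<close>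

definition off_diag_tails :: "nat \<Rightarrow> nat \<Rightarrow> nat \<Rightarrow> nat list set" where
  "off_diag_tails m n i = multi_indices (m - 1) n - {replicate (m - 1) i}"

definition r_plus :: "nat \<Rightarrow> nat \<Rightarrow> (nat list \<Rightarrow> real) \<Rightarrow> nat \<Rightarrow> real" where
  "r_plus m n A i = Max (insert 0 ((\<lambda>js. A (i # js)) ` off_diag_tails m n i))"

definition doubly_B_tensor :: "nat \<Rightarrow> nat \<Rightarrow> (nat list \<Rightarrow> real) \<Rightarrow> bool" where
  "doubly_B_tensor m n A \<longleftrightarrow>
    (\<forall>i\<in>{1..n}. diag_entry m A i > r_plus m n A i) \<and>
    (\<forall>i\<in>{1..n}. \<forall>j\<in>{1..n}. i \<noteq> j \<longrightarrow>
      (diag_entry m A i - r_plus m n A i) * (diag_entry m A j - r_plus m n A j) >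
      (\<Sum>is\<in>off_diag_tails m n i. r_plus m n A i - A (i # is)) *
      (\<Sum>js\<in>off_diag_tails m n j. r_plus m n A j - A (j # js)))"

definition strictly_doubly_diag_dominated :: "nat \<Rightarrow> nat \<Rightarrow> (nat list \<Rightarrow> real) \<Rightarrow> bool" where
  "strictly_doubly_diag_dominated m n B \<longleftrightarrow>
    (\<forall>i\<in>{1..n}. diag_entry m B i > 0) \<and>
    (\<forall>i\<in>{1..n}. \<forall>j\<in>{1..n}. i \<noteq> j \<longrightarrow>
      diag_entry m B i * diag_entry m B j >
      (\<Sum>is\<in>off_diag_tails m n i. \<bar>B (i # is)\<bar>) *
      (\<Sum>js\<in>off_diag_tails m n j. \<bar>B (j # js)\<bar>))"

definition plus_tensor :: "nat \<Rightarrow> nat \<Rightarrow> (nat list \<Rightarrow> real) \<Rightarrow> nat list \<Rightarrow> real" where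
  "plus_tensor m n A = (\<lambda>is\<in>multi_indices m n. A is - r_plus m n A (hd is))"

text \<open>In particular the maximum in \<open>r_plus\<close> and the sums above are over finite sets.\<close>

lemma finite_multi_indices: "finite (multi_indices m n)"
  using finite_lists_length_eq[of "{1..n}" m]
  by (simp add: multi_indices_def conj_commute)

lemma finite_off_diag_tails: "finite (off_diag_tails m n i)"
  by (simp add: off_diag_tails_def finite_multi_indices)

lemma plus_tensor_in_tensors: "plus_tensor m n A \<in> tensors m n"
  by (simp add: plus_tensor_def tensors_def)

end

theory Submission imports Defs begin

text \<open>Since \<open>r_plus\<close> bounds the off-diagonal entries of its row from above,
  subtracting it makes them nonpositive, so their absolute values are exactly the differences summed
  in \<open>doubly_B_tensor\<close> (\<open>abs_plus_tensor_off_diag\<close>). The diagonal is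
  shifted by the same amount (\<open>diag_entry_plus_tensor\<close>), so the two definitions agree
  condition by condition.\<close>

lemma off_diag_entry_le_r_plus:
  "js \<in> off_diag_tails m n i \<Longrightarrow> A (i # js) \<le> r_plus m n A i"
  unfolding r_plus_def by (intro Max_ge) (auto simp: finite_off_diag_tails)

lemma Cons_in_multi_indices:
  assumes "m \<ge> 1" "i \<in> {1..n}" "js \<in> multi_indices (m - 1) n"
  shows "i # js \<in> multi_indices m n"
  using assms by (auto simp: multi_indices_def)

lemma diag_entry_plus_tensor:
  assumes "m \<ge> 1" "i \<in> {1..n}"
  shows "diag_entry m (plus_tensor m n A) i = diag_entry m A i - r_plus m n A i"
  \<comment> \<open>For \<open>m = Suc k\<close> the head of \<open>replicate m i\<close> is
    \<open>i\<close>, so the shift is that of row \<open>i\<close>.\<close>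
  using assms by (cases m) (auto simp: diag_entry_def plus_tensor_def multi_indices_def)

lemma abs_plus_tensor_off_diag:
  assumes "m \<ge> 1" "i \<in> {1..n}" "js \<in> off_diag_tails m n i"
  shows "\<bar>plus_tensor m n A (i # js)\<bar> = r_plus m n A i - A (i # js)"
proof -
  \<comment> \<open>\<open>plus_tensor\<close> is given by its formula only on valid
    multi-indices.\<close>
  have "i # js \<in> multi_indices m n"
    using assms by (intro Cons_in_multi_indices) (auto simp: off_diag_tails_def)
  then show ?thesis
    using off_diag_entry_le_r_plus[OF assms(3), of A] by (simp add: plus_tensor_def)
qed

theorem corollary2:
  fixes m n :: nat and A :: "nat list \<Rightarrow> real"
  assumes "m \<ge> 2" and "n \<ge> 1" and "A \<in> tensors m n"
  shows "doubly_B_tensor m n A \<longleftrightarrow>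
    strictly_doubly_diag_dominated m n (plus_tensor m n A)"
proof -
  have "m \<ge> 1" using assms(1) by simp
  note diag = diag_entry_plus_tensor[OF this]
    and off_diag = abs_plus_tensor_off_diag[OF this]
  have sums: "(\<Sum>js\<in>off_diag_tails m n i. \<bar>plus_tensor m n A (i # js)\<bar>) =
      (\<Sum>js\<in>off_diag_tails m n i. r_plus m n A i - A (i # js))" if "i \<in> {1..n}" for i
    using off_diag[OF that] by (intro sum.cong) auto
  show ?thesis
    unfolding doubly_B_tensor_def strictly_doubly_diag_dominated_def
    \<comment> \<open>\<open>ball_cong\<close> supplies the range assumptions on which
      \<open>diag\<close> and \<open>sums\<close> are conditional; positivity of the shifted
      diagonal is then \<open>r_plus m n A i < diag_entry m A i\<close>.\<close>
    by (simp add: diag sums del: atLeastAtMost_iff cong: ball_cong)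
qed

end
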